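(* Let $\mathcal{C}$ be the class of all semigroups satisfying $$(\forall a)(\exists x)(\forall b)\colon\ axb=abx.$$ Then $\mathcal{C}$ is not the class of all semigroups satisfying some set of equation systems of the type $(\forall\cdots)(\exists\cdots)$, nor is it the class of all semigroups satisfying some set of equation systems of the type $(\exists\cdots)(\forall\cdots)$.
   Context: Semigroups are non-empty. A (semigroup) equation system is a first-order sentence in the language of one binary multiplication consisting of a finite string of quantifiers $\forall,\exists$ followed by a finite conjunction of equalities between semigroup words (non-empty words, i.e. elements of a free semigroup) in the quantified symbols; there are no constants. An equation system is of the type $(\forall\cdots)(\exists\cdots)$ if in its quantifier string all universal quantifiers precede all existential ones, and of the type $(\exists\cdots)(\forall\cdots)$ if all existential quantifiers precede all universal ones. *)

theory Defs
  imports Main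
begin

text \<open>
  A structure has an explicit carrier inside an ambient type 'a, so that semigroups of every
  cardinality up to that of 'a (in particular finite ones) are represented.  Two records that
  differ only in the values of the multiplication outside the carrier are the same semigroup.
\<close>

record 'a magma =
  carrier :: "'a set"
  mult :: "'a \<Rightarrow> 'a \<Rightarrow> 'a"

definition semigroup_struct :: "'a magma \<Rightarrow> bool" where
  "semigroup_struct G \<longleftrightarrow>
     carrier G \<noteq> {} \<and>
     (\<forall>a\<in>carrier G. \<forall>b\<in>carrier G. mult G a b \<in> carrier G) \<and>
     (\<forall>a\<in>carrier G. \<forall>b\<in>carrier G. \<forall>c\<in>carrier G.
        mult G (mult G a b) c = mult G a (mult G b c))"

datatype quantifier = Forall | Exists

text \<open>The leftmost list entry is the outermost quantifier; symbols are natural numbers.\<close>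

type_synonym word = "nat list"

record equation_system =
  quants :: "(quantifier \<times> nat) list"
  eqns :: "(word \<times> word) list"

text \<open>
  Each symbol is quantified once, every word is non-empty, and no symbol is free.  The
  conjunction may be empty, which adds only sentences that are true in every semigroup.
\<close>

definition wf_system :: "equation_system \<Rightarrow> bool" where
  "wf_system E \<longleftrightarrow>
     distinct (map snd (quants E)) \<and>
     (\<forall>(u, v)\<in>set (eqns E).
        u \<noteq> [] \<and> v \<noteq> [] \<and> set u \<union> set v \<subseteq> set (map snd (quants E)))"

definition forall_exists_type :: "equation_system \<Rightarrow> bool" where
  "forall_exists_type E \<longleftrightarrow>
     (\<exists>m n. map fst (quants E) = replicate m Forall @ replicate n Exists)"

definition exists_forall_type :: "equation_system \<Rightarrow> bool" where
  "exists_forall_type E \<longleftrightarrow>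
     (\<exists>m n. map fst (quants E) = replicate m Exists @ replicate n Forall)"

text \<open>The value of the empty word is irrelevant, since it does not occur in well-formed systems.\<close>

fun word_value :: "'a magma \<Rightarrow> (nat \<Rightarrow> 'a) \<Rightarrow> word \<Rightarrow> 'a" where
  "word_value G \<rho> [] = undefined"
| "word_value G \<rho> [x] = \<rho> x"
| "word_value G \<rho> (x # y # w) = mult G (\<rho> x) (word_value G \<rho> (y # w))"

fun holds :: "'a magma \<Rightarrow> (nat \<Rightarrow> 'a) \<Rightarrow> (quantifier \<times> nat) list \<Rightarrow> (word \<times> word) list \<Rightarrow> bool" where
  "holds G \<rho> [] es \<longleftrightarrow> (\<forall>(u, v)\<in>set es. word_value G \<rho> u = word_value G \<rho> v)"
| "holds G \<rho> ((Forall, x) # qs) es \<longleftrightarrow> (\<forall>a\<in>carrier G. holds G (\<rho>(x := a)) qs es)"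
| "holds G \<rho> ((Exists, x) # qs) es \<longleftrightarrow> (\<exists>a\<in>carrier G. holds G (\<rho>(x := a)) qs es)"

text \<open>Well-formed systems are closed, so the choice of the initial assignment is immaterial.\<close>

definition satisfies :: "'a magma \<Rightarrow> equation_system \<Rightarrow> bool" where
  "satisfies G E \<longleftrightarrow> (\<forall>\<rho>. holds G \<rho> (quants E) (eqns E))"

definition semigroups_satisfying :: "equation_system set \<Rightarrow> 'a magma set" where
  "semigroups_satisfying S = {G. semigroup_struct G \<and> (\<forall>E\<in>S. satisfies G E)}"

definition class_C :: "'a magma set" where
  "class_C = {G. semigroup_struct G \<and>
     (\<forall>a\<in>carrier G. \<exists>x\<in>carrier G. \<forall>b\<in>carrier G.
        mult G (mult G a x) b = mult G (mult G a b) x)}"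

lemma class_C_eq_semigroups_satisfying:
  "class_C = semigroups_satisfying
     {\<lparr>quants = [(Forall, 0), (Exists, 1), (Forall, 2)], eqns = [([0, 1, 2], [0, 2, 1])]\<rparr>}"
  by (auto simp: class_C_def semigroups_satisfying_def satisfies_def semigroup_struct_def)

end

theory Submission
  imports Defs "HOL-Library.Countable"
begin

text \<open>
  For the prefix \<open>\<forall>\<exists>\<close>: such systems pass from the members of a chain of subsemigroups to its
  union.  The ordinal sum over the natural numbers of two-element right zero semigroups, in which
  larger levels absorb smaller ones, is the union of the chain of its subsemigroups consisting of
  the levels up to \<open>n\<close> and one element of level \<open>n + 1\<close>.  That element is a zero, so these
  subsemigroups belong to the class; the union does not.

  For the prefix \<open>\<exists>\<forall>\<close>: consider the non-empty words over letters that carry a level, where in a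
  product those letters of the right factor are deleted whose level exceeds that of some letter of
  the left factor.  This semigroup is in the class, since a letter of high level is deleted whenever
  it is multiplied to \<open>a\<close> or \<open>a b\<close> from the right.  Evaluating the universal variables
  at distinct letters of a level above all letters of the witnesses shows that, in each equation
  of a valid system, the two sides agree up to the first existential variable.  Hence the system
  holds in every semigroup with a left zero, and some such semigroups are not in the class.
\<close>

section \<open>Transport along an injection\<close>

text \<open>The examples are built on countable types and copied into an arbitrary infinite type.
  Off the range of \<open>h\<close> the product is junk, which is harmless because the carrier lies
  inside the range.\<close>

definition image_magma :: "('b \<Rightarrow> 'a) \<Rightarrow> 'b magma \<Rightarrow> 'a magma" where
  "image_magma h M = \<lparr>carrier = h ` carrier M, mult = (\<lambda>x y. h (mult M (inv h x) (inv h y)))\<rparr>"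

lemma carrier_image_magma [simp]: "carrier (image_magma h M) = h ` carrier M"
  by (simp add: image_magma_def)

lemma mult_image_magma [simp]:
  "inj h \<Longrightarrow> mult (image_magma h M) (h x) (h y) = h (mult M x y)"
  by (simp add: image_magma_def)

lemma semigroup_struct_image_magma:
  assumes "inj h" "semigroup_struct M"
  shows "semigroup_struct (image_magma h M)"
  using assms by (auto simp: semigroup_struct_def)

lemma image_magma_in_class_C_iff:
  assumes "inj h" "semigroup_struct M"
  shows "image_magma h M \<in> class_C \<longleftrightarrow> M \<in> class_C"
  using assms semigroup_struct_image_magma[OF assms]
  by (simp add: class_C_def inj_eq)

lemma word_value_image_magma:
  assumes "inj h" "w \<noteq> []"
  shows "word_value (image_magma h M) (h \<circ> \<rho>) w = h (word_value M \<rho> w)"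
  using assms(2) by (induction M \<rho> w rule: word_value.induct) (simp_all add: assms(1))

text \<open>Empty words are excluded because their value is \<open>undefined\<close>, which
  \<open>h\<close> need not preserve.\<close>

lemma holds_image_magma_iff:
  assumes "inj h" "\<forall>(u, v)\<in>set es. u \<noteq> [] \<and> v \<noteq> []"
  shows "holds (image_magma h M) (h \<circ> \<rho>) qs es \<longleftrightarrow> holds M \<rho> qs es"
proof (induction qs arbitrary: \<rho>)
  case Nil
  have "word_value (image_magma h M) (h \<circ> \<rho>) u = word_value (image_magma h M) (h \<circ> \<rho>) v
      \<longleftrightarrow> word_value M \<rho> u = word_value M \<rho> v" if "(u, v) \<in> set es" for u v
  proof -
    have "u \<noteq> []" "v \<noteq> []"
      using assms(2) that by auto
    then show ?thesis
      using assms(1) by (simp add: word_value_image_magma inj_eq)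
  qed
  then show ?case
    unfolding holds.simps by fast
next
  case (Cons q qs)
  have upd: "(h \<circ> \<rho>)(x := h a) = h \<circ> \<rho>(x := a)" for x a
    by auto
  obtain k x where "q = (k, x)"
    by fastforce
  then show ?case
    by (cases k) (simp_all only: holds.simps carrier_image_magma ball_simps bex_simps upd Cons.IH)
qed

lemma satisfies_image_magmaD:
  assumes "inj h" "wf_system E" "satisfies (image_magma h M) E"
  shows "satisfies M E"
proof -
  have "\<forall>(u, v)\<in>set (eqns E). u \<noteq> [] \<and> v \<noteq> []"
    using assms(2) by (auto simp: wf_system_def)
  from holds_image_magma_iff[OF assms(1) this] assms(3) show ?thesis
    unfolding satisfies_def by blast
qed

lemma ex_inj_countable_into_infinite:
  assumes "infinite (UNIV :: 'a set)"
  shows "\<exists>h :: 'b :: countable \<Rightarrow> 'a. inj h"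
proof -
  obtain f :: "nat \<Rightarrow> 'a" where "inj f"
    using infinite_countable_subset[OF assms] by blast
  then have "inj (f \<circ> (to_nat :: 'b \<Rightarrow> nat))"
    by (intro inj_compose inj_to_nat)
  then show ?thesis by blast
qed

section \<open>Universal-existential systems and chains\<close>

lemma map_fst_eq_replicate_appendD:
  assumes "map fst ps = replicate m a @ replicate n b"
  obtains xs ys where "ps = map (Pair a) xs @ map (Pair b) ys"
proof
  have *: "qs = map (Pair c) (map snd qs)" if "map fst qs = replicate k c" for qs c and k :: nat
    using that by (induction qs arbitrary: k) (auto simp: Cons_replicate_eq)
  have "map fst (take m ps) = replicate m a" "map fst (drop m ps) = replicate n b"
    using assms by (simp_all flip: take_map drop_map)
  then show "ps = map (Pair a) (map snd (take m ps)) @ map (Pair b) (map snd (drop m ps))"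
    using * append_take_drop_id by metis
qed

lemma word_value_update_carrier [simp]:
  "word_value (M\<lparr>carrier := K\<rparr>) \<rho> w = word_value M \<rho> w"
  by (induction M \<rho> w rule: word_value.induct) simp_all

lemma holds_exists_mono:
  assumes "holds (M\<lparr>carrier := K\<rparr>) \<rho> (map (Pair Exists) xs) es" "K \<subseteq> carrier M"
  shows "holds M \<rho> (map (Pair Exists) xs) es"
  using assms by (induction xs arbitrary: \<rho>) auto

text \<open>Each universal value lies in all late members of the chain, so fixing it only raises the
  threshold \<open>n0\<close>. Once all are fixed, witnesses found in a single member serve in the
  union.\<close>

lemma holds_forall_exists_chain_union:
  fixes K :: "nat \<Rightarrow> 'a set"
  assumes "carrier M = (\<Union>n. K n)" "mono K"
    and "\<And>n. n \<ge> n0 \<Longrightarrow>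
           holds (M\<lparr>carrier := K n\<rparr>) \<rho> (map (Pair Forall) ys @ map (Pair Exists) xs) es"
  shows "holds M \<rho> (map (Pair Forall) ys @ map (Pair Exists) xs) es"
  using assms(3)
proof (induction ys arbitrary: \<rho> n0)
  case Nil
  then have "holds (M\<lparr>carrier := K n0\<rparr>) \<rho> (map (Pair Exists) xs) es"
    by simp
  then show ?case
    using holds_exists_mono assms(1) by fastforce
next
  case (Cons y ys)
  have "holds M (\<rho>(y := a)) (map (Pair Forall) ys @ map (Pair Exists) xs) es"
    if a: "a \<in> carrier M" for a
  proof -
    obtain m where "a \<in> K m"
      using a assms(1) by auto
    then have "a \<in> K n" if "n \<ge> m" for n
      using monoD[OF assms(2) that] by blast
    then show ?thesis
      using Cons.prems by (intro Cons.IH[of "max n0 m"]) (simp del: fun_upd_apply)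
  qed
  then show ?case by simp
qed

lemma satisfies_forall_exists_chain_union:
  fixes K :: "nat \<Rightarrow> 'a set"
  assumes "forall_exists_type E" "carrier M = (\<Union>n. K n)" "mono K"
    and "\<And>n. satisfies (M\<lparr>carrier := K n\<rparr>) E"
  shows "satisfies M E"
proof -
  obtain xs ys where "quants E = map (Pair Forall) ys @ map (Pair Exists) xs"
    using assms(1) map_fst_eq_replicate_appendD unfolding forall_exists_type_def by metis
  then show ?thesis
    using assms(4) holds_forall_exists_chain_union[OF assms(2,3)]
    unfolding satisfies_def by simp
qed

section \<open>The tower of two-element right zero semigroups\<close>

definition right_zero_tower :: "(nat \<times> bool) magma" where
  "right_zero_tower = \<lparr>carrier = UNIV, mult = (\<lambda>p q. if fst p > fst q then p else q)\<rparr>"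

definition tower_part :: "nat \<Rightarrow> (nat \<times> bool) set" where
  "tower_part n = insert (Suc n, False) {p. fst p \<le> n}"

lemma right_zero_tower_sel [simp]:
  "carrier right_zero_tower = UNIV"
  "mult right_zero_tower p q = (if fst p > fst q then p else q)"
  by (simp_all add: right_zero_tower_def)

lemma semigroup_struct_right_zero_tower: "semigroup_struct right_zero_tower"
  by (simp add: semigroup_struct_def)

lemma right_zero_tower_not_in_class_C: "right_zero_tower \<notin> class_C"
proof
  assume "right_zero_tower \<in> class_C"
  then obtain x where x: "\<And>b. mult right_zero_tower (mult right_zero_tower (0, False) x) b
      = mult right_zero_tower (mult right_zero_tower (0, False) b) x"
    unfolding class_C_def mem_Collect_eq right_zero_tower_sel(1) by blast
  \<comment> \<open>With \<open>b\<close> the other element on the level of \<open>x\<close>, the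
    lowest-level \<open>a\<close> is absorbed, and the two products are \<open>b\<close> and
    \<open>x\<close>.\<close>
  show False
    using x[of "(fst x, \<not> snd x)"] by (cases x) simp
qed

lemma semigroup_struct_tower_part:
  "semigroup_struct (right_zero_tower\<lparr>carrier := tower_part n\<rparr>)"
  by (auto simp: semigroup_struct_def tower_part_def)

lemma tower_part_in_class_C: "right_zero_tower\<lparr>carrier := tower_part n\<rparr> \<in> class_C"
proof -
  have "\<forall>a\<in>tower_part n. \<forall>b\<in>tower_part n.
      mult right_zero_tower (mult right_zero_tower a (Suc n, False)) b =
      mult right_zero_tower (mult right_zero_tower a b) (Suc n, False)"
    by (auto simp: tower_part_def)
  then show ?thesis
    using semigroup_struct_tower_part
    by (auto simp: class_C_def tower_part_def intro!: bexI[of _ "(Suc n, False)"])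
qed

lemma mono_tower_part: "mono (\<lambda>n. h ` (tower_part n))"
  by (rule monoI, rule image_mono) (auto simp: tower_part_def)

theorem class_C_not_forall_exists:
  assumes "infinite (UNIV :: 'a set)" "\<forall>E\<in>S. forall_exists_type E"
  shows "(class_C :: 'a magma set) \<noteq> semigroups_satisfying S"
proof
  assume C: "(class_C :: 'a magma set) = semigroups_satisfying S"
  obtain h :: "nat \<times> bool \<Rightarrow> 'a" where h: "inj h"
    using ex_inj_countable_into_infinite[OF assms(1)] by blast
  define M where "M = image_magma h right_zero_tower"
  have part: "M\<lparr>carrier := h ` tower_part n\<rparr> \<in> class_C" for n
  proof -
    have "M\<lparr>carrier := h ` tower_part n\<rparr>
        = image_magma h (right_zero_tower\<lparr>carrier := tower_part n\<rparr>)"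
      by (simp add: M_def image_magma_def)
    then show ?thesis
      using image_magma_in_class_C_iff[OF h semigroup_struct_tower_part] tower_part_in_class_C
      by simp
  qed
  have un: "carrier M = (\<Union>n. h ` tower_part n)"
    by (force simp: M_def tower_part_def)
  have "satisfies M E" if "E \<in> S" for E
    using satisfies_forall_exists_chain_union[OF _ un mono_tower_part] part assms(2) that
    unfolding C semigroups_satisfying_def by blast
  moreover have "semigroup_struct M"
    unfolding M_def by (intro semigroup_struct_image_magma h semigroup_struct_right_zero_tower)
  ultimately have "M \<in> class_C"
    unfolding C semigroups_satisfying_def by blast
  then show False
    using image_magma_in_class_C_iff[OF h semigroup_struct_right_zero_tower]
      right_zero_tower_not_in_class_C
    unfolding M_def by blast
qed

section \<open>Existential-universal systems and left zeros\<close>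

lemma holds_existsD:
  assumes "holds M \<rho> (map (Pair Exists) xs @ qs) es"
  shows "\<exists>\<sigma>. (\<forall>x\<in>set xs. \<sigma> x \<in> carrier M) \<and> holds M \<sigma> qs es"
proof -
  \<comment> \<open>Agreement with \<open>\<rho>\<close> off \<open>xs\<close> is added for the
    induction: it keeps the value of the head variable if the tail does not bind it again.\<close>
  have "\<exists>\<sigma>. (\<forall>x\<in>set xs. \<sigma> x \<in> carrier M) \<and> (\<forall>v. v \<notin> set xs \<longrightarrow> \<sigma> v = \<rho> v)
      \<and> holds M \<sigma> qs es"
    using assms
  proof (induction xs arbitrary: \<rho>)
    case (Cons x xs)
    then obtain a \<sigma> where "a \<in> carrier M" "\<forall>x\<in>set xs. \<sigma> x \<in> carrier M"
      "\<forall>v. v \<notin> set xs \<longrightarrow> \<sigma> v = (\<rho>(x := a)) v" "holds M \<sigma> qs es"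
      by fastforce
    then show ?case
      by (intro exI[of _ \<sigma>]) (metis fun_upd_apply set_ConsD list.set_intros)
  qed auto
  then show ?thesis by blast
qed

lemma holds_existsI:
  assumes "holds M (override_on \<rho> f (set xs)) qs es" "f ` set xs \<subseteq> carrier M"
  shows "holds M \<rho> (map (Pair Exists) xs @ qs) es"
  using assms
proof (induction xs arbitrary: \<rho>)
  case (Cons x xs)
  have "override_on (\<rho>(x := f x)) f (set xs) = override_on \<rho> f (set (x # xs))"
    by (auto simp: override_on_def)
  then have "holds M (\<rho>(x := f x)) (map (Pair Exists) xs @ qs) es"
    using Cons by (simp del: fun_upd_apply)
  then show ?case
    using Cons.prems(2) by auto
qed simp

lemma holds_forallD:
  assumes "holds M \<rho> (map (Pair Forall) ys) es" "f ` set ys \<subseteq> carrier M" "(u, v) \<in> set es"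
  shows "word_value M (override_on \<rho> f (set ys)) u = word_value M (override_on \<rho> f (set ys)) v"
  using assms
proof (induction ys arbitrary: \<rho>)
  case (Cons y ys)
  have "override_on (\<rho>(y := f y)) f (set ys) = override_on \<rho> f (set (y # ys))"
    by (auto simp: override_on_def)
  then show ?case
    using Cons by fastforce
qed auto

lemma holds_forallI:
  assumes "\<And>\<sigma> u v. \<lbrakk>\<forall>x. x \<notin> set ys \<longrightarrow> \<sigma> x = \<rho> x; \<forall>y\<in>set ys. \<sigma> y \<in> carrier M;
             (u, v) \<in> set es\<rbrakk> \<Longrightarrow> word_value M \<sigma> u = word_value M \<sigma> v"
  shows "holds M \<rho> (map (Pair Forall) ys) es"
  using assms
proof (induction ys arbitrary: \<rho>)
  case (Cons y ys)
  have "holds M (\<rho>(y := a)) (map (Pair Forall) ys) es" if "a \<in> carrier M" for a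
  proof (rule Cons.IH)
    fix \<sigma> u v
    assume "\<forall>x. x \<notin> set ys \<longrightarrow> \<sigma> x = (\<rho>(y := a)) x" "\<forall>x\<in>set ys. \<sigma> x \<in> carrier M"
      "(u, v) \<in> set es"
    then show "word_value M \<sigma> u = word_value M \<sigma> v"
      using that by (intro Cons.prems) (metis fun_upd_apply set_ConsD list.set_intros)+
  qed
  then show ?case by simp
qed auto

section \<open>The deletion semigroup and universal prefixes\<close>

definition deletion_words :: "(nat \<times> nat) list magma" where
  "deletion_words = \<lparr>carrier = {a. a \<noteq> []},
     mult = (\<lambda>a b. a @ filter (\<lambda>l. \<forall>k\<in>set a. fst l \<le> fst k) b)\<rparr>"

lemma deletion_words_sel [simp]:
  "carrier deletion_words = {a. a \<noteq> []}"
  "mult deletion_words a b = a @ filter (\<lambda>l. \<forall>k\<in>set a. fst l \<le> fst k) b"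
  by (simp_all add: deletion_words_def)

text \<open>A deleted letter of \<open>b\<close> lies above some letter of \<open>a\<close>, so the
  least level in the product is the minimum of the least levels of \<open>a\<close> and
  \<open>b\<close>. Filtering by the product is thus filtering by both factors.\<close>

lemma deletion_words_assoc:
  "mult deletion_words (mult deletion_words a b) c
    = mult deletion_words a (mult deletion_words b c)"
proof -
  have "(\<forall>k\<in>set (a @ filter (\<lambda>l. \<forall>k\<in>set a. fst l \<le> fst k) b). fst l \<le> fst k)
      \<longleftrightarrow> (\<forall>k\<in>set b. fst l \<le> fst k) \<and> (\<forall>k\<in>set a. fst l \<le> fst k)" (is "?L \<longleftrightarrow> ?R")
    for l :: "nat \<times> nat"
  proof
    assume L: ?L
    have "fst l \<le> fst k" if "k \<in> set b" for k
    proof (cases "\<forall>j\<in>set a. fst k \<le> fst j")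
      case True
      then show ?thesis
        using L that by simp
    next
      case False
      then obtain j where "j \<in> set a" "fst j < fst k"
        by (meson not_le)
      moreover from this have "fst l \<le> fst j"
        using L by simp
      ultimately show ?thesis by simp
    qed
    then show ?R
      using L by simp
  qed auto
  then show ?thesis
    unfolding deletion_words_sel filter_append filter_filter append_assoc by presburger
qed

lemma semigroup_struct_deletion_words: "semigroup_struct deletion_words"
  unfolding semigroup_struct_def deletion_words_assoc by auto

lemma deletion_words_in_class_C: "deletion_words \<in> class_C"
proof -
  have "\<exists>x\<in>carrier deletion_words. \<forall>b\<in>carrier deletion_words.
      mult deletion_words (mult deletion_words a x) b = mult deletion_words (mult deletion_words a b) x"
    if "a \<in> carrier deletion_words" for a
  proof (intro bexI ballI)
    \<comment> \<open>The witness lies one level above the first letter of \<open>a\<close>, so both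
      sides reduce to the product of \<open>a\<close> and \<open>b\<close>.\<close>
    show "mult deletion_words (mult deletion_words a [(Suc (fst (hd a)), 0)]) b
        = mult deletion_words (mult deletion_words a b) [(Suc (fst (hd a)), 0)]" for b
      using that by (cases a) auto
  qed simp
  then show ?thesis
    using semigroup_struct_deletion_words unfolding class_C_def by blast
qed

text \<open>Here \<open>X\<close> stands for the existential variables. A letter of level
  \<open>n\<close> deletes only letters above \<open>n\<close>, so multiplying by it from the left
  preserves the spelled-out universal prefix and the lower letter that ends it. The second component
  of a letter records which variable it stands for.\<close>

lemma word_value_deletion_words:
  assumes "w \<noteq> []"
    and "\<And>v. v \<in> set w \<Longrightarrow> v \<notin> X \<Longrightarrow> \<rho> v = [(n, v)]"
    and "\<And>v. v \<in> set w \<Longrightarrow> v \<in> X \<Longrightarrow> \<rho> v \<noteq> [] \<and> fst (hd (\<rho> v)) < n"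
  shows "\<exists>r. word_value deletion_words \<rho> w = map (Pair n) (takeWhile (\<lambda>v. v \<notin> X) w) @ r
    \<and> (r = [] \<longleftrightarrow> set w \<inter> X = {}) \<and> (r \<noteq> [] \<longrightarrow> fst (hd r) < n)"
  using assms
proof (induction w rule: induct_list012)
  case (2 x)
  then show ?case by auto
next
  case (3 x y w)
  show ?case
  proof (cases "x \<in> X")
    case True
    then show ?thesis
      using "3.prems"(3)[of x] by simp
  next
    case False
    obtain r where r:
      "word_value deletion_words \<rho> (y # w) = map (Pair n) (takeWhile (\<lambda>v. v \<notin> X) (y # w)) @ r"
      "r = [] \<longleftrightarrow> set (y # w) \<inter> X = {}" "r \<noteq> [] \<longrightarrow> fst (hd r) < n"
      using "3.IH"(2) "3.prems" by auto
    have "filter (\<lambda>l. fst l \<le> n) (map (Pair n) p) = map (Pair n) p" for p :: "nat list"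
      by simp
    \<comment> \<open>The head of \<open>r\<close> survives the filter, being below level
      \<open>n\<close>.\<close>
    moreover have "filter (\<lambda>l. fst l \<le> n) r = [] \<longleftrightarrow> r = []"
      "r \<noteq> [] \<longrightarrow> fst (hd (filter (\<lambda>l. fst l \<le> n) r)) < n"
      using r(3) by (cases r; simp)+
    ultimately show ?thesis
      using False "3.prems"(2)[of x] r(1,2)
      by (intro exI[of _ "filter (\<lambda>l. fst l \<le> n) r"]) simp
  qed
qed simp

text \<open>The prefix can be read off the value of a word by cutting at the first letter not of
  level \<open>n\<close>. What remains is empty exactly if no existential variable occurs.\<close>

lemma equal_universal_prefixes:
  assumes "holds deletion_words \<sigma> (map (Pair Forall) ys) es" "(u, v) \<in> set es" "u \<noteq> []" "v \<noteq> []"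
    and "\<forall>x\<in>set xs. \<sigma> x \<noteq> []" "set u \<union> set v \<subseteq> set xs \<union> set ys" "set xs \<inter> set ys = {}"
  shows "takeWhile (\<lambda>x. x \<notin> set xs) u = takeWhile (\<lambda>x. x \<notin> set xs) v
    \<and> (set u \<inter> set xs = {} \<longleftrightarrow> set v \<inter> set xs = {})"
proof -
  \<comment> \<open>Only the first letters of the witnesses have to lie below \<open>n\<close>. The
    inserted 0 keeps \<open>Max\<close> meaningful when \<open>xs\<close> is empty.\<close>
  define n where "n = Suc (Max (insert 0 ((\<lambda>x. fst (hd (\<sigma> x))) ` set xs)))"
  define \<rho> where "\<rho> = override_on \<sigma> (\<lambda>y. [(n, y)]) (set ys)"
  have eq: "word_value deletion_words \<rho> u = word_value deletion_words \<rho> v"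
    unfolding \<rho>_def by (rule holds_forallD[OF assms(1) _ assms(2)]) auto
  have "fst (hd (\<sigma> x)) < n" if "x \<in> set xs" for x
    using that by (simp add: n_def less_Suc_eq_le)
  then have \<rho>_xs: "\<rho> x \<noteq> [] \<and> fst (hd (\<rho> x)) < n" if "x \<in> set xs" for x
    using that assms(5,7) by (auto simp: \<rho>_def override_on_def)
  have \<rho>_ys: "\<rho> x = [(n, x)]" if "x \<in> set u \<union> set v" "x \<notin> set xs" for x
    using that assms(6) by (auto simp: \<rho>_def override_on_def)
  obtain r where r: "word_value deletion_words \<rho> u = map (Pair n) (takeWhile (\<lambda>x. x \<notin> set xs) u) @ r"
    "r = [] \<longleftrightarrow> set u \<inter> set xs = {}" "r \<noteq> [] \<longrightarrow> fst (hd r) < n"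
    using word_value_deletion_words[OF assms(3), of "set xs" \<rho> n] \<rho>_xs \<rho>_ys by auto
  obtain s where s: "word_value deletion_words \<rho> v = map (Pair n) (takeWhile (\<lambda>x. x \<notin> set xs) v) @ s"
    "s = [] \<longleftrightarrow> set v \<inter> set xs = {}" "s \<noteq> [] \<longrightarrow> fst (hd s) < n"
    using word_value_deletion_words[OF assms(4), of "set xs" \<rho> n] \<rho>_xs \<rho>_ys by auto
  have *: "takeWhile (\<lambda>l. fst l = n) (map (Pair n) p @ t) = map (Pair n) p"
    if "t \<noteq> [] \<longrightarrow> fst (hd t) < n" for p and t :: "(nat \<times> nat) list"
    using that by (cases t) (auto simp: takeWhile_append)
  have "map (Pair n) (takeWhile (\<lambda>x. x \<notin> set xs) u) = map (Pair n) (takeWhile (\<lambda>x. x \<notin> set xs) v)"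
    using *[OF r(3)] *[OF s(3)] eq r(1) s(1) by metis
  moreover from this have "r = s"
    using eq r(1) s(1) by simp
  ultimately show ?thesis
    using r(2) s(2) by (simp add: inj_map_eq_map inj_on_def)
qed

section \<open>Evaluation in a semigroup with a left zero\<close>

lemma word_value_closed:
  assumes "semigroup_struct M" "w \<noteq> []" "\<rho> ` set w \<subseteq> carrier M"
  shows "word_value M \<rho> w \<in> carrier M"
  using assms by (induction M \<rho> w rule: word_value.induct) (auto simp: semigroup_struct_def)

text \<open>The first variable from \<open>X\<close> has value \<open>z\<close>, which swallows
  everything to its right; the prefix then acts on \<open>z\<close> by left multiplications.\<close>

lemma word_value_left_zero:
  assumes "semigroup_struct M" "\<And>t. t \<in> carrier M \<Longrightarrow> mult M z t = z"
    and "\<rho> ` set w \<subseteq> carrier M" "\<And>x. x \<in> X \<Longrightarrow> \<rho> x = z" "set w \<inter> X \<noteq> {}"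
  shows "word_value M \<rho> w = foldr (\<lambda>v. mult M (\<rho> v)) (takeWhile (\<lambda>v. v \<notin> X) w) z"
  using assms
proof (induction M \<rho> w rule: word_value.induct)
  case (3 M \<rho> x y w)
  show ?case
  proof (cases "x \<in> X")
    case True
    moreover have "word_value M \<rho> (y # w) \<in> carrier M"
      using 3 by (intro word_value_closed) auto
    ultimately show ?thesis
      using 3 by simp
  next
    case False
    then show ?thesis
      using 3 by auto
  qed
qed auto

lemma satisfies_exists_forall_left_zero:
  assumes "wf_system E" "exists_forall_type E" "satisfies deletion_words E"
    and "semigroup_struct M" "z \<in> carrier M" "\<And>t. t \<in> carrier M \<Longrightarrow> mult M z t = z"
  shows "satisfies M E"
  unfolding satisfies_def
proof
  fix \<rho>
  obtain xs ys where q: "quants E = map (Pair Exists) xs @ map (Pair Forall) ys"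
    using assms(2) map_fst_eq_replicate_appendD unfolding exists_forall_type_def by metis
  have wf: "set xs \<inter> set ys = {}"
    "u \<noteq> [] \<and> v \<noteq> [] \<and> set u \<union> set v \<subseteq> set xs \<union> set ys" if "(u, v) \<in> set (eqns E)" for u v
    using assms(1) that by (auto simp: wf_system_def q comp_def)
  obtain \<sigma> where \<sigma>: "\<forall>x\<in>set xs. \<sigma> x \<noteq> []" "holds deletion_words \<sigma> (map (Pair Forall) ys) (eqns E)"
    using assms(3) holds_existsD[of deletion_words undefined xs]
    unfolding satisfies_def q deletion_words_sel(1) by blast
  show "holds M \<rho> (quants E) (eqns E)"
    unfolding q
  \<comment> \<open>Every existential variable takes the left zero as its value.\<close>
  proof (rule holds_existsI[where f = "\<lambda>_. z"], rule holds_forallI)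
    fix \<tau> u v
    assume \<tau>: "\<forall>x. x \<notin> set ys \<longrightarrow> \<tau> x = override_on \<rho> (\<lambda>_. z) (set xs) x"
      "\<forall>y\<in>set ys. \<tau> y \<in> carrier M" and uv: "(u, v) \<in> set (eqns E)"
    have pre: "takeWhile (\<lambda>x. x \<notin> set xs) u = takeWhile (\<lambda>x. x \<notin> set xs) v"
      "set u \<inter> set xs = {} \<longleftrightarrow> set v \<inter> set xs = {}"
      using equal_universal_prefixes[OF \<sigma>(2) uv _ _ \<sigma>(1)] wf[OF uv] by auto
    have \<tau>_xs: "\<tau> x = z" if "x \<in> set xs" for x
      using that \<tau>(1) wf(1)[OF uv] by (auto simp: override_on_def)
    then have closed: "\<tau> ` set u \<subseteq> carrier M" "\<tau> ` set v \<subseteq> carrier M"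
      using \<tau>(2) wf(2)[OF uv] assms(5) by blast+
    show "word_value M \<tau> u = word_value M \<tau> v"
    proof (cases "set u \<inter> set xs = {}")
      \<comment> \<open>Without existential variables the prefixes are the whole words, so the
        equation is literally \<open>u = u\<close>.\<close>
      case True
      then have "u = takeWhile (\<lambda>x. x \<notin> set xs) u" "v = takeWhile (\<lambda>x. x \<notin> set xs) v"
        using pre(2) by (auto simp: takeWhile_eq_all_conv[THEN iffD2] disjoint_iff)
      then show ?thesis
        using pre(1) by simp
    next
      case False
      then show ?thesis
        using word_value_left_zero[OF assms(4,6) _ \<tau>_xs] closed pre by simp
    qed
  qed (use assms(5) in auto)
qed

text \<open>
  On \<open>Inl\<close> this is the direct product of the right zero semigroup and the group of order two, which
  acts through its second factor on the left zeros \<open>Inr\<close>.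
\<close>

fun acting_mult :: "(bool \<times> bool) + bool \<Rightarrow> (bool \<times> bool) + bool \<Rightarrow> (bool \<times> bool) + bool" where
  "acting_mult (Inl (r, g)) (Inl (s, h)) = Inl (s, g \<noteq> h)"
| "acting_mult (Inl (r, g)) (Inr l) = Inr (g \<noteq> l)"
| "acting_mult (Inr l) t = Inr l"

definition acting_magma :: "((bool \<times> bool) + bool) magma" where
  "acting_magma = \<lparr>carrier = UNIV, mult = acting_mult\<rparr>"

lemma acting_magma_sel [simp]:
  "carrier acting_magma = UNIV" "mult acting_magma = acting_mult"
  by (simp_all add: acting_magma_def)

lemma semigroup_struct_acting_magma: "semigroup_struct acting_magma"
proof -
  have "acting_mult (acting_mult a b) c = acting_mult a (acting_mult b c)" for a b c
    by (cases "(a, b)" rule: acting_mult.cases; cases c) auto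
  then show ?thesis
    by (simp add: semigroup_struct_def)
qed

lemma acting_magma_not_in_class_C: "acting_magma \<notin> class_C"
proof
  assume "acting_magma \<in> class_C"
  then obtain x where x: "\<And>b. acting_mult (acting_mult (Inl (False, False)) x) b
      = acting_mult (acting_mult (Inl (False, False)) b) x"
    unfolding class_C_def mem_Collect_eq acting_magma_sel by blast
  \<comment> \<open>The chosen \<open>a\<close> is a left identity, so \<open>x\<close> would
    commute with every \<open>b\<close>. An \<open>Inl\<close> element fails to commute with one of
    different right zero coordinate, and an \<open>Inr\<close> element is moved by the group element
    of order two.\<close>
  show False
  proof (cases x)
    case (Inl p)
    then show ?thesis
      using x[of "Inl (\<not> fst p, False)"] by (cases p) simp
  next
    case (Inr l)
    then show ?thesis
      using x[of "Inl (False, True)"] by simp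
  qed
qed

theorem class_C_not_exists_forall:
  assumes "infinite (UNIV :: 'a set)" "\<forall>E\<in>S. wf_system E \<and> exists_forall_type E"
  shows "(class_C :: 'a magma set) \<noteq> semigroups_satisfying S"
proof
  assume C: "(class_C :: 'a magma set) = semigroups_satisfying S"
  obtain h :: "(nat \<times> nat) list \<Rightarrow> 'a" where h: "inj h"
    using ex_inj_countable_into_infinite[OF assms(1)] by blast
  obtain k :: "(bool \<times> bool) + bool \<Rightarrow> 'a" where k: "inj k"
    using ex_inj_countable_into_infinite[OF assms(1)] by blast
  define M where "M = image_magma k acting_magma"
  have M: "semigroup_struct M"
    unfolding M_def by (intro semigroup_struct_image_magma k semigroup_struct_acting_magma)
  have "image_magma h deletion_words \<in> class_C"
    using image_magma_in_class_C_iff[OF h semigroup_struct_deletion_words]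
      deletion_words_in_class_C by simp
  \<comment> \<open>Membership in the class gives the systems of \<open>S\<close> for the copy
    inside \<open>'a\<close>; they are pulled back along \<open>h\<close>.\<close>
  then have "satisfies deletion_words E" if "E \<in> S" for E
    using that assms(2) satisfies_image_magmaD[OF h]
    unfolding C semigroups_satisfying_def by blast
  moreover have "k (Inr False) \<in> carrier M" "\<And>t. t \<in> carrier M \<Longrightarrow> mult M (k (Inr False)) t = k (Inr False)"
    using k by (auto simp: M_def)
  ultimately have "satisfies M E" if "E \<in> S" for E
    using that assms(2) M satisfies_exists_forall_left_zero[of E M] by blast
  then have "M \<in> class_C"
    unfolding C semigroups_satisfying_def using M by blast
  then show False
    using image_magma_in_class_C_iff[OF k semigroup_struct_acting_magma]
      acting_magma_not_in_class_C
    unfolding M_def by blast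
qed

theorem mainTheorem3:
  assumes "infinite (UNIV :: 'a set)"
  shows "\<not> (\<exists>S. (\<forall>E\<in>S. wf_system E \<and> forall_exists_type E) \<and>
                (class_C :: 'a magma set) = semigroups_satisfying S)
       \<and> \<not> (\<exists>S. (\<forall>E\<in>S. wf_system E \<and> exists_forall_type E) \<and>
                (class_C :: 'a magma set) = semigroups_satisfying S)"
  using class_C_not_forall_exists[OF assms] class_C_not_exists_forall[OF assms] by blast

end
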